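(* Let $f$ be a locally integrable function on $\mathbb{R}^2$. Then $f\in bmo$ if and only if $f\in\mathcal{BMO}_{\mathcal{R}}$.
   Context: $\mathcal{R}$ is the family of all (bounded, non-degenerate) rectangles in $\mathbb{R}^2=\mathbb{R}\times\mathbb{R}$ with sides parallel to the axes, and $f_R=\frac1{|R|}\int_Rf\,dx$. The space $bmo$ ("little BMO") consists of the locally integrable $f$ with $$\|f\|_{bmo}:=\sup_{R\in\mathcal{R}}\frac1{|R|}\int_R|f-f_R|\,dx<\infty.$$ The space $\mathcal{BMO}_{\mathcal{R}}$ consists of the locally integrable $f$ with $$\|f\|_{\mathcal{BMO}_{\mathcal{R}}}:=\sup_{R\in\mathcal{R}}\|f-f_R\|_{\exp L,R}<\infty,\qquad\|g\|_{\exp L,R}:=\inf\Big\{\lambda>0:\ \frac1{|R|}\int_Re^{|g|/\lambda}\,dx\le2\Big\}.$$ *)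

theory Defs
  imports "HOL-Analysis.Analysis"
begin

definition rectangles :: "(real \<times> real) set set" where
  "rectangles = {{a..b} \<times> {c..d} | a b c d. a < b \<and> c < d}"

definition locally_integrable ::
    "(real \<times> real \<Rightarrow> 'a::{banach, second_countable_topology}) \<Rightarrow> bool" where
  "locally_integrable f \<longleftrightarrow> (\<forall>K. compact K \<longrightarrow> set_integrable lebesgue K f)"

definition avg ::
    "(real \<times> real \<Rightarrow> 'a::{banach, second_countable_topology}) \<Rightarrow> (real \<times> real) set \<Rightarrow> 'a" where
  "avg f R = (1 / measure lebesgue R) *\<^sub>R (LINT x:R|lebesgue. f x)"

text \<open>Averages of nonnegative functions, and the norms built from them, take values in
  \<^typ>\<open>ennreal\<close>, so that a divergent integral has the value \<open>\<infinity>\<close>.\<close>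

definition nn_avg :: "(real \<times> real \<Rightarrow> ennreal) \<Rightarrow> (real \<times> real) set \<Rightarrow> ennreal" where
  "nn_avg h R = (\<integral>\<^sup>+x\<in>R. h x \<partial>lebesgue) / emeasure lebesgue R"

definition bmo_norm ::
    "(real \<times> real \<Rightarrow> 'a::{banach, second_countable_topology}) \<Rightarrow> ennreal" where
  "bmo_norm f = (SUP R\<in>rectangles. nn_avg (\<lambda>x. ennreal (norm (f x - avg f R))) R)"

definition bmo :: "(real \<times> real \<Rightarrow> 'a::{banach, second_countable_topology}) set" where
  "bmo = {f. locally_integrable f \<and> bmo_norm f < \<infinity>}"

text \<open>In \<^typ>\<open>ennreal\<close> the infimum of the empty set is \<open>\<infinity>\<close>.\<close>

definition expL_norm ::
    "(real \<times> real) set \<Rightarrow> (real \<times> real \<Rightarrow> 'a::{banach, second_countable_topology}) \<Rightarrow> ennreal" where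
  "expL_norm R g =
     Inf {ennreal t | t. t > 0 \<and> nn_avg (\<lambda>x. ennreal (exp (norm (g x) / t))) R \<le> 2}"

definition BMO_R_norm ::
    "(real \<times> real \<Rightarrow> 'a::{banach, second_countable_topology}) \<Rightarrow> ennreal" where
  "BMO_R_norm f = (SUP R\<in>rectangles. expL_norm R (\<lambda>x. f x - avg f R))"

definition BMO_R :: "(real \<times> real \<Rightarrow> 'a::{banach, second_countable_topology}) set" where
  "BMO_R = {f. locally_integrable f \<and> BMO_R_norm f < \<infinity>}"

end

theory Submission
  imports Defs
begin

text \<open>The nontrivial direction is the John--Nirenberg inequality on rectangles. Bisect \<open>R\<close> repeatedly and
  replace \<open>f\<close> by its averages over the cells of the resulting partition. For this discrete
  version, a stopping-time argument bounds the exponential integral of \<open>\<bar>f - f\<^sub>R\<bar> / (40 * M)\<close> by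
  \<open>2 * |R|\<close>, where \<open>M\<close> exceeds the bmo norm. As continuous functions are dense in \<open>L\<^sup>1\<close>, fine
  partitions approximate \<open>f\<close> in \<open>L\<^sup>1(R)\<close>, so the bound passes to \<open>min (exp (\<bar>f - f\<^sub>R\<bar> / (40 * M))) K\<close>,
  which is Lipschitz in \<open>f\<close>, and then by monotone convergence to the exponential itself; no
  differentiation theorem is needed.\<close>

section \<open>Rectangles as compact sets of positive finite measure\<close>

lemma rectangles_compact: "R \<in> rectangles \<Longrightarrow> compact R"
  unfolding rectangles_def by (auto intro!: compact_Times)

lemma rectangles_lmeasurable: "R \<in> rectangles \<Longrightarrow> R \<in> lmeasurable"
  by (simp add: lmeasurable_compact rectangles_compact)

lemma rectangles_sets: "R \<in> rectangles \<Longrightarrow> R \<in> sets lebesgue"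
  by (simp add: fmeasurableD rectangles_lmeasurable)

lemma measure_rectangle:
  assumes "a \<le> b" "c \<le> d"
  shows "measure lebesgue ({a..b} \<times> {c..d}) = (b - a) * (d - c :: real)"
proof -
  have "{a..b} \<times> {c..d} = cbox (a, c) (b, d)"
    by (simp add: cbox_Pair_eq)
  then show ?thesis
    using assms by (simp add: content_cbox_if box_eq_empty Basis_prod_def prod.union_disjoint
        prod.reindex inj_on_def disjoint_iff)
qed

lemma measure_rectangles_pos: "R \<in> rectangles \<Longrightarrow> measure lebesgue R > 0"
  by (auto simp: rectangles_def measure_rectangle)

lemma emeasure_rectangles: "R \<in> rectangles \<Longrightarrow> emeasure lebesgue R = ennreal (measure lebesgue R)"
  by (simp add: emeasure_eq_measure2 rectangles_lmeasurable)

section \<open>Bisections and the partitions they generate\<close>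

text \<open>Rectangles are closed, so the two halves share an edge; a negligible intersection stands
  in for disjointness. Leaving the direction of the cut open lets a single induction serve both
  kinds of cut.\<close>

definition bisects ::
    "(real \<times> real) set \<Rightarrow> (real \<times> real) set \<Rightarrow> (real \<times> real) set \<Rightarrow> bool" where
  "bisects R P Q \<longleftrightarrow> R \<in> rectangles \<and> P \<in> rectangles \<and> Q \<in> rectangles \<and> R = P \<union> Q \<and>
     measure lebesgue P = measure lebesgue R / 2 \<and> measure lebesgue Q = measure lebesgue R / 2 \<and>
     negligible (P \<inter> Q)"

text \<open>A derivation records the tree of cuts, so rule induction descends from a rectangle to
  its two halves, as a stopping-time argument requires. Keeping the cells in a list makes sums split
  along \<open>@\<close> without any reasoning about distinctness.\<close>

inductive bisection_partition :: "(real \<times> real) set \<Rightarrow> (real \<times> real) set list \<Rightarrow> bool" where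
  whole: "R \<in> rectangles \<Longrightarrow> bisection_partition R [R]"
| bisect: "bisects R P Q \<Longrightarrow> bisection_partition P ps \<Longrightarrow> bisection_partition Q qs \<Longrightarrow>
    bisection_partition R (ps @ qs)"

lemma bisects_horizontal:
  assumes "a < b" "c < (d::real)"
  shows "bisects ({a..b} \<times> {c..d}) ({a..(a+b)/2} \<times> {c..d}) ({(a+b)/2..b} \<times> {c..d})"
proof -
  have "{a..(a+b)/2} \<times> {c..d} \<inter> {(a+b)/2..b} \<times> {c..d} = cbox ((a+b)/2, c) ((a+b)/2, d)"
    using assms by (auto simp: cbox_Pair_eq)
  moreover have "negligible (cbox ((a+b)/2, c) ((a+b)/2, d))"
    by (auto simp: negligible_interval box_eq_empty Basis_prod_def)
  ultimately have "negligible ({a..(a+b)/2} \<times> {c..d} \<inter> {(a+b)/2..b} \<times> {c..d})"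
    by simp
  moreover have "{a..(a+b)/2} \<times> {c..d} \<in> rectangles" "{(a+b)/2..b} \<times> {c..d} \<in> rectangles" "{a..b} \<times> {c..d} \<in> rectangles"
    unfolding rectangles_def using assms by force+
  moreover have "{a..b} = {a..(a+b)/2} \<union> {(a+b)/2..b}"
    using assms by auto
  then have "{a..b} \<times> {c..d} = {a..(a+b)/2} \<times> {c..d} \<union> {(a+b)/2..b} \<times> {c..d}"
    by (simp only: Sigma_Un_distrib1)
  moreover have "measure lebesgue ({a..(a+b)/2} \<times> {c..d}) = measure lebesgue ({a..b} \<times> {c..d}) / 2"
    "measure lebesgue ({(a+b)/2..b} \<times> {c..d}) = measure lebesgue ({a..b} \<times> {c..d}) / 2"
    using assms by (simp_all add: measure_rectangle field_simps)
  ultimately show ?thesis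
    unfolding bisects_def by blast
qed

lemma bisects_vertical:
  assumes "a < b" "c < (d::real)"
  shows "bisects ({a..b} \<times> {c..d}) ({a..b} \<times> {c..(c+d)/2}) ({a..b} \<times> {(c+d)/2..d})"
proof -
  have "{a..b} \<times> {c..(c+d)/2} \<inter> {a..b} \<times> {(c+d)/2..d} = cbox (a, (c+d)/2) (b, (c+d)/2)"
    using assms by (auto simp: cbox_Pair_eq)
  moreover have "negligible (cbox (a, (c+d)/2) (b, (c+d)/2))"
    by (auto simp: negligible_interval box_eq_empty Basis_prod_def)
  ultimately have "negligible ({a..b} \<times> {c..(c+d)/2} \<inter> {a..b} \<times> {(c+d)/2..d})"
    by simp
  moreover have "{a..b} \<times> {c..(c+d)/2} \<in> rectangles" "{a..b} \<times> {(c+d)/2..d} \<in> rectangles" "{a..b} \<times> {c..d} \<in> rectangles"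
    unfolding rectangles_def using assms by force+
  moreover have "{c..d} = {c..(c+d)/2} \<union> {(c+d)/2..d}"
    using assms by auto
  then have "{a..b} \<times> {c..d} = {a..b} \<times> {c..(c+d)/2} \<union> {a..b} \<times> {(c+d)/2..d}"
    by (simp only: Sigma_Un_distrib2)
  moreover have "measure lebesgue ({a..b} \<times> {c..(c+d)/2}) = measure lebesgue ({a..b} \<times> {c..d}) / 2"
    "measure lebesgue ({a..b} \<times> {(c+d)/2..d}) = measure lebesgue ({a..b} \<times> {c..d}) / 2"
    using assms by (simp_all add: measure_rectangle field_simps)
  ultimately show ?thesis
    unfolding bisects_def by blast
qed

lemma bisection_partition_cells:
  assumes "bisection_partition R xs"
  shows "R \<in> rectangles \<and> (\<forall>Q\<in>set xs. Q \<in> rectangles \<and> Q \<subseteq> R)"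
  using assms by induction (auto simp: bisects_def)

text \<open>Additivity is demanded only for cuts inside \<open>R\<close>, so that integrability on
  \<open>R\<close> is enough when \<open>h\<close> is a set integral.\<close>

lemma bisection_partition_additive:
  assumes "bisection_partition R xs"
    and "\<And>S P Q. bisects S P Q \<Longrightarrow> S \<subseteq> R \<Longrightarrow> h S = h P + (h Q :: real)"
  shows "(\<Sum>Q\<leftarrow>xs. h Q) = h R"
  using assms
proof (induction)
  case (bisect R P Q ps qs)
  have "P \<subseteq> R" "Q \<subseteq> R" using bisect.hyps(1) by (auto simp: bisects_def)
  then have "(\<Sum>Q\<leftarrow>ps. h Q) = h P" "(\<Sum>Q\<leftarrow>qs. h Q) = h Q"
    using bisect by blast+
  then show ?case using bisect.prems[OF bisect.hyps(1)] by simp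
qed simp

lemma set_integral_bisects:
  fixes f :: "real \<times> real \<Rightarrow> 'a::{banach, second_countable_topology}"
  assumes "bisects R P Q" "set_integrable lebesgue R f"
  shows "(LINT x:R|lebesgue. f x) = (LINT x:P|lebesgue. f x) + (LINT x:Q|lebesgue. f x)"
proof -
  have *: "P \<in> sets lebesgue" "Q \<in> sets lebesgue" "R = P \<union> Q" "P \<inter> Q \<in> null_sets lebesgue"
    using assms(1) by (auto simp: bisects_def rectangles_sets negligible_iff_null_sets)
  have "AE x in lebesgue. \<not> (x \<in> P \<and> x \<in> Q)"
    using AE_not_in[OF *(4)] by simp
  moreover have "set_integrable lebesgue P f" "set_integrable lebesgue Q f"
    using assms(2) * by (auto intro: set_integrable_subset)
  ultimately show ?thesis
    using * set_integral_Un_AE[where A = P and B = Q and f = f and M = lebesgue] by simp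
qed

lemma bisection_partition_set_integral:
  fixes h :: "real \<times> real \<Rightarrow> real"
  assumes "bisection_partition R xs" "set_integrable lebesgue R h"
  shows "(\<Sum>Q\<leftarrow>xs. LINT x:Q|lebesgue. h x) = (LINT x:R|lebesgue. h x)"
proof (rule bisection_partition_additive[OF assms(1)])
  fix S P Q assume "bisects S P Q" "S \<subseteq> R"
  moreover from this have "set_integrable lebesgue S h"
    using assms(2) by (auto intro: set_integrable_subset simp: bisects_def rectangles_sets)
  ultimately show "(LINT x:S|lebesgue. h x) = (LINT x:P|lebesgue. h x) + (LINT x:Q|lebesgue. h x)"
    using set_integral_bisects by blast
qed

lemma bisection_partition_measure:
  assumes "bisection_partition R xs"
  shows "(\<Sum>Q\<leftarrow>xs. measure lebesgue Q) = measure lebesgue R"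
  by (rule bisection_partition_additive[OF assms]) (auto simp: bisects_def)

text \<open>One horizontal and one vertical cut halve both side lengths at once; each of the four
  quarters then receives \<open>n\<close> further rounds by induction.\<close>

lemma exists_small_bisection_partition:
  assumes "a < b" "c < (d::real)"
  shows "\<exists>xs. bisection_partition ({a..b} \<times> {c..d}) xs \<and>
    (\<forall>Q\<in>set xs. \<exists>a' b' c' d'. Q = {a'..b'} \<times> {c'..d'} \<and>
        b' - a' = (b - a) / 2 ^ n \<and> d' - c' = (d - c) / 2 ^ n)"
  using assms
proof (induction n arbitrary: a b c d)
  case 0
  then have "bisection_partition ({a..b} \<times> {c..d}) [{a..b} \<times> {c..d}]"
    by (intro bisection_partition.whole) (auto simp: rectangles_def)
  then show ?case by force
next
  case (Suc n)
  define m k where "m = (a + b) / 2" and "k = (c + d) / 2"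
  have mk: "a < m" "m < b" "c < k" "k < d"
    using Suc.prems by (auto simp: m_def k_def)
  have halves: "(m - a) / 2 ^ n = (b - a) / 2 ^ Suc n" "(b - m) / 2 ^ n = (b - a) / 2 ^ Suc n"
    "(k - c) / 2 ^ n = (d - c) / 2 ^ Suc n" "(d - k) / 2 ^ n = (d - c) / 2 ^ Suc n"
    by (simp_all add: m_def k_def field_simps)
  \<comment> \<open>Cell sizes are measured against the sides of the original rectangle, so all four
    quarters yield literally the same predicate.\<close>
  define small where "small = (\<lambda>Q. \<exists>a' b' c' d'. Q = {a'..b'} \<times> {c'..d'} \<and>
        b' - a' = (b - a) / 2 ^ Suc n \<and> d' - c' = (d - c) / 2 ^ Suc n)"
  obtain x1 where x1: "bisection_partition ({a..m} \<times> {c..k}) x1" "\<forall>Q\<in>set x1. small Q"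
    using Suc.IH[OF mk(1,3)] unfolding halves small_def by (elim exE conjE)
  obtain x2 where x2: "bisection_partition ({m..b} \<times> {c..k}) x2" "\<forall>Q\<in>set x2. small Q"
    using Suc.IH[OF mk(2,3)] unfolding halves small_def by (elim exE conjE)
  obtain x3 where x3: "bisection_partition ({a..m} \<times> {k..d}) x3" "\<forall>Q\<in>set x3. small Q"
    using Suc.IH[OF mk(1,4)] unfolding halves small_def by (elim exE conjE)
  obtain x4 where x4: "bisection_partition ({m..b} \<times> {k..d}) x4" "\<forall>Q\<in>set x4. small Q"
    using Suc.IH[OF mk(2,4)] unfolding halves small_def by (elim exE conjE)
  have "bisection_partition ({a..b} \<times> {c..k}) (x1 @ x2)"
    using bisects_horizontal[OF Suc.prems(1) mk(3)] x1(1) x2(1) unfolding m_def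
    by (rule bisection_partition.bisect)
  moreover have "bisection_partition ({a..b} \<times> {k..d}) (x3 @ x4)"
    using bisects_horizontal[OF Suc.prems(1) mk(4)] x3(1) x4(1) unfolding m_def
    by (rule bisection_partition.bisect)
  ultimately have "bisection_partition ({a..b} \<times> {c..d}) ((x1 @ x2) @ (x3 @ x4))"
    using bisects_vertical[OF Suc.prems] bisection_partition.bisect unfolding k_def by blast
  moreover have "\<forall>Q\<in>set ((x1 @ x2) @ (x3 @ x4)). small Q"
    using x1(2) x2(2) x3(2) x4(2) by auto
  ultimately show ?case
    unfolding small_def by (intro exI conjI)
qed

lemma exists_fine_bisection_partition:
  assumes "R \<in> rectangles" "\<delta> > 0"
  shows "\<exists>xs. bisection_partition R xs \<and> (\<forall>Q\<in>set xs. \<forall>x\<in>Q. \<forall>y\<in>Q. dist x y < \<delta>)"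
proof -
  obtain a b c d where R: "R = {a..b} \<times> {c..d}" "a < b" "c < d"
    using assms(1) by (auto simp: rectangles_def)
  have "(\<lambda>n. ((b - a) + (d - c)) * (1/2) ^ n) \<longlonglongrightarrow> ((b - a) + (d - c)) * 0"
    by (intro tendsto_intros) auto
  then have "eventually (\<lambda>n. ((b - a) + (d - c)) * (1/2) ^ n < \<delta>) sequentially"
    using assms(2) by (intro order_tendstoD(2)) auto
  then obtain n where n: "((b - a) + (d - c)) * (1/2) ^ n < \<delta>"
    by (auto simp: eventually_sequentially)
  obtain xs where xs: "bisection_partition R xs"
    "\<forall>Q\<in>set xs. \<exists>a' b' c' d'. Q = {a'..b'} \<times> {c'..d'} \<and>
        b' - a' = (b - a) / 2 ^ n \<and> d' - c' = (d - c) / 2 ^ n"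
    using exists_small_bisection_partition[OF R(2,3), of n] unfolding R(1)[symmetric]
    by (elim exE conjE)
  have "dist x y < \<delta>" if Q: "Q \<in> set xs" "x \<in> Q" "y \<in> Q" for Q x y
  proof -
    obtain a' b' c' d' where Q': "Q = {a'..b'} \<times> {c'..d'}"
        "b' - a' = (b - a) / 2 ^ n" "d' - c' = (d - c) / 2 ^ n"
      using bspec[OF xs(2) Q(1)] by (elim exE conjE)
    obtain x1 x2 y1 y2 where xy: "x = (x1, x2)" "y = (y1, y2)" by (cases x, cases y) auto
    \<comment> \<open>The diameter of a cell is at most the sum of its side lengths, which decays
      geometrically in \<open>n\<close>.\<close>
    have "dist x y \<le> dist x1 y1 + dist x2 y2"
      unfolding xy dist_Pair_Pair by (simp add: sqrt_sum_squares_le_sum)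
    also have "\<dots> \<le> (b' - a') + (d' - c')"
      using Q(2,3) by (auto simp: Q'(1) xy dist_real_def)
    also have "\<dots> = ((b - a) + (d - c)) * (1/2) ^ n"
      by (simp add: Q'(2,3) power_divide add_divide_distrib)
    finally show ?thesis using n by simp
  qed
  with xs(1) show ?thesis by blast
qed

section \<open>Set integrals and averages over a rectangle\<close>

lemma set_integrable_const_rectangle:
  fixes c :: "'a::{banach, second_countable_topology}"
  assumes "R \<in> rectangles"
  shows "set_integrable lebesgue R (\<lambda>_. c)"
  unfolding set_integrable_def
  by (intro integrable_scaleR_left integrable_real_indicator rectangles_sets[OF assms]
      fmeasurableD2[OF rectangles_lmeasurable[OF assms], unfolded top.not_eq_extremum, folded infinity_ennreal_def])

lemma set_integral_const_rectangle:
  fixes c :: "'a::{banach, second_countable_topology}"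
  assumes "R \<in> rectangles"
  shows "(LINT x:R|lebesgue. c) = measure lebesgue R *\<^sub>R c"
  by (rule set_integral_const[OF rectangles_sets[OF assms],
        unfolded infinity_ennreal_def, OF fmeasurableD2[OF rectangles_lmeasurable[OF assms]]])

lemma set_integrable_norm:
  fixes f :: "'b \<Rightarrow> 'a::{banach, second_countable_topology}"
  assumes "set_integrable M R f"
  shows "set_integrable M R (\<lambda>x. norm (f x))"
  using assms integrable_norm[of M "\<lambda>x. indicator R x *\<^sub>R f x"] unfolding set_integrable_def
  by simp

lemma set_integrable_norm_diff:
  fixes f g :: "real \<times> real \<Rightarrow> 'a::{banach, second_countable_topology}"
  assumes "set_integrable M R f" "set_integrable M R g"
  shows "set_integrable M R (\<lambda>x. norm (f x - g x))"
  using assms by (intro set_integrable_norm set_integral_diff)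

text \<open>This is the bound of the norm of an integral by the integral of the norm, applied to
  \<open>f - c\<close>. Multiplying by the measure avoids a division.\<close>

lemma norm_avg_diff_le:
  fixes f :: "real \<times> real \<Rightarrow> 'a::{banach, second_countable_topology}"
  assumes "R \<in> rectangles" "set_integrable lebesgue R f"
  shows "measure lebesgue R * norm (avg f R - c) \<le> (LINT x:R|lebesgue. norm (f x - c))"
proof -
  note c = set_integrable_const_rectangle[OF assms(1), of c]
  have m: "measure lebesgue R > 0" by (rule measure_rectangles_pos[OF assms(1)])
  have "(LINT x:R|lebesgue. f x - c) = measure lebesgue R *\<^sub>R (avg f R - c)"
    using m by (simp add: set_integral_diff(2)[OF assms(2) c] set_integral_const_rectangle[OF assms(1)]
        avg_def scaleR_diff_right)
  then have "measure lebesgue R * norm (avg f R - c) = norm (LINT x:R|lebesgue. f x - c)"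
    using m by simp
  also have "\<dots> \<le> (LINT x:R|lebesgue. norm (f x - c))"
    unfolding set_lebesgue_integral_def
    by (rule order_trans[OF integral_norm_bound]) simp
  finally show ?thesis .
qed

text \<open>Passing from \<open>R\<close> to \<open>S\<close> only decreases the integral of the
  oscillation around \<open>avg f R\<close>, while the measure drops by exactly one half; this is
  the source of the factor 2.\<close>

lemma norm_avg_bisects_le:
  fixes f :: "real \<times> real \<Rightarrow> 'a::{banach, second_countable_topology}"
  assumes "R \<in> rectangles" "S \<in> rectangles" "S \<subseteq> R" "measure lebesgue S = measure lebesgue R / 2"
    and f: "set_integrable lebesgue R f"
    and M: "(LINT x:R|lebesgue. norm (f x - avg f R)) \<le> M * measure lebesgue R"
  shows "norm (avg f S - avg f R) \<le> 2 * M"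
proof -
  have fS: "set_integrable lebesgue S f"
    using f assms(2,3) by (auto intro: set_integrable_subset rectangles_sets)
  have fR: "set_integrable lebesgue R (\<lambda>x. norm (f x - avg f R))"
    using f assms(1) by (intro set_integrable_norm_diff set_integrable_const_rectangle)
  have "measure lebesgue S * norm (avg f S - avg f R) \<le> (LINT x:S|lebesgue. norm (f x - avg f R))"
    by (rule norm_avg_diff_le[OF assms(2) fS])
  also have "\<dots> \<le> (LINT x:R|lebesgue. norm (f x - avg f R))"
    using fR set_integrable_subset[OF fR rectangles_sets[OF assms(2)] assms(3)] assms(3)
    unfolding set_lebesgue_integral_def set_integrable_def
    by (intro integral_mono) (auto simp: indicator_def)
  also have "\<dots> \<le> measure lebesgue S * (2 * M)"
    using M by (simp add: assms(4) mult.commute)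
  finally show ?thesis
    using measure_rectangles_pos[OF assms(2)] by simp
qed

section \<open>The exponential bound for averages over a partition\<close>

text \<open>The scale \<open>40 * M\<close> is chosen to make this true: distances
  \<open>4 * M\<close> and \<open>6 * M\<close> between averages become the exponents 4/40 = 1/10
  and 6/40 = 3/20. The quadratic bound for \<open>exp\<close> gives about 1.7 on the left.\<close>

lemma exp_tenth_add_half_exp_le_2: "exp (1/10) + exp (3/20) / 2 \<le> (2::real)"
  using exp_bound[of "1/10"] exp_bound[of "3/20"] by (simp add: power2_eq_square)

text \<open>The Calderon-Zygmund stopping-time argument, run as an induction over the bisections:
  a half whose average is within \<open>4 * M\<close> of \<open>c\<close> is treated by the induction hypothesis, and
  the total measure of the halves where this fails is controlled by \<open>\<integral>\<bar>f - c\<bar> / (4 * M)\<close>, while there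
  \<open>c\<close> can be replaced by the average of the half at the cost of a factor \<open>exp (6 / 40)\<close>, because
  averages change by at most \<open>2 * M\<close> from a rectangle to its halves.\<close>

lemma exp_sum_bisection_partition_aux:
  fixes f :: "real \<times> real \<Rightarrow> 'a::{banach, second_countable_topology}"
  assumes "bisection_partition R xs"
    and f: "\<And>Q. Q \<in> rectangles \<Longrightarrow> set_integrable lebesgue Q f"
    and osc: "\<And>Q. Q \<in> rectangles \<Longrightarrow>
      (LINT x:Q|lebesgue. norm (f x - avg f Q)) \<le> M * measure lebesgue Q"
    and "M > 0"
    and "norm (avg f R - c) \<le> 4 * M"
  shows "(\<Sum>Q\<leftarrow>xs. measure lebesgue Q * exp (norm (avg f Q - c) / (40 * M)))
    \<le> measure lebesgue R * exp (1/10) + exp (3/20) / (2 * M) * (LINT x:R|lebesgue. norm (f x - c))"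
  using assms(1,5)
proof (induction arbitrary: c)
  case (whole R)
  have "exp (norm (avg f R - c) / (40 * M)) \<le> exp (1/10)"
    using whole.prems \<open>M > 0\<close> by (simp add: field_simps)
  then have "measure lebesgue R * exp (norm (avg f R - c) / (40 * M)) \<le> measure lebesgue R * exp (1/10)"
    by (intro mult_left_mono) auto
  moreover have "0 \<le> exp (3/20) / (2 * M) * (LINT x:R|lebesgue. norm (f x - c))"
    using \<open>M > 0\<close> unfolding set_lebesgue_integral_def
    by (intro mult_nonneg_nonneg integral_nonneg_AE) auto
  ultimately show ?case by simp
next
  case (bisect R P Q ps qs)
  note R = bisect.hyps(1)[unfolded bisects_def]
  \<comment> \<open>The induction hypothesis is carried along for every centre, since a half on
    which the process stops is restarted with its own average in place of \<open>c\<close>.\<close>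
  have half: "(\<Sum>Q\<leftarrow>ys. measure lebesgue Q * exp (norm (avg f Q - c) / (40 * M)))
    \<le> measure lebesgue S * exp (1/10) + exp (3/20) / (2 * M) * (LINT x:S|lebesgue. norm (f x - c))"
    if S: "S \<in> rectangles" "S \<subseteq> R" "measure lebesgue S = measure lebesgue R / 2"
      and IH: "\<And>c. norm (avg f S - c) \<le> 4 * M \<Longrightarrow>
        (\<Sum>Q\<leftarrow>ys. measure lebesgue Q * exp (norm (avg f Q - c) / (40 * M)))
        \<le> measure lebesgue S * exp (1/10) + exp (3/20) / (2 * M) * (LINT x:S|lebesgue. norm (f x - c))"
    for S ys
  proof (cases "norm (avg f S - c) \<le> 4 * M")
    case True
    then show ?thesis by (rule IH)
  next
    case False
    have "norm (avg f S - avg f R) \<le> 2 * M"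
      using R S f osc by (intro norm_avg_bisects_le) auto
    then have near: "norm (avg f S - c) \<le> 6 * M"
      using bisect.prems norm_triangle_ineq[of "avg f S - avg f R" "avg f R - c"] by simp
    have shift: "exp (norm (avg f Q - c) / (40 * M)) \<le>
        exp (3/20) * exp (norm (avg f Q - avg f S) / (40 * M))" for Q
    proof -
      have "norm (avg f Q - c) \<le> 6 * M + norm (avg f Q - avg f S)"
        using near norm_triangle_ineq[of "avg f Q - avg f S" "avg f S - c"] by simp
      then show ?thesis
        using \<open>M > 0\<close> by (simp add: field_simps flip: exp_add)
    qed
    \<comment> \<open>With the centre \<open>avg f S\<close> the closeness condition is trivial, and
      the bmo bound turns the integral into at most \<open>M * measure lebesgue S\<close>.\<close>
    have "(\<Sum>Q\<leftarrow>ys. measure lebesgue Q * exp (norm (avg f Q - avg f S) / (40 * M)))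
        \<le> measure lebesgue S * exp (1/10)
          + exp (3/20) / (2 * M) * (LINT x:S|lebesgue. norm (f x - avg f S))"
      using \<open>M > 0\<close> by (intro IH) simp
    also have "\<dots> \<le> measure lebesgue S * exp (1/10)
          + exp (3/20) / (2 * M) * (M * measure lebesgue S)"
      using \<open>M > 0\<close> osc[OF S(1)] by (intro add_left_mono mult_left_mono) auto
    also have "\<dots> = measure lebesgue S * (exp (1/10) + exp (3/20) / 2)"
      using \<open>M > 0\<close> by (simp add: field_simps)
    also have "\<dots> \<le> measure lebesgue S * 2"
      using exp_tenth_add_half_exp_le_2 by (intro mult_left_mono) auto
    finally have centred: "(\<Sum>Q\<leftarrow>ys. measure lebesgue Q * exp (norm (avg f Q - avg f S) / (40 * M)))
        \<le> measure lebesgue S * 2" .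
    have "(\<Sum>Q\<leftarrow>ys. measure lebesgue Q * exp (norm (avg f Q - c) / (40 * M)))
        \<le> (\<Sum>Q\<leftarrow>ys. exp (3/20) * (measure lebesgue Q * exp (norm (avg f Q - avg f S) / (40 * M))))"
      using mult_left_mono[OF shift measure_nonneg] by (intro sum_list_mono) (simp add: mult_ac)
    also have "\<dots> \<le> exp (3/20) * (measure lebesgue S * 2)"
      unfolding sum_list_const_mult using centred by simp
    \<comment> \<open>This explains the coefficient \<open>exp (3/20) / (2 * M)\<close> in the
      claim: the cost 2 per unit of measure is rewritten with a factor \<open>4 * M\<close>, which
      the stopping condition dominates by \<open>norm (avg f S - c)\<close>, hence by the integral
      over \<open>S\<close>.\<close>
    also have "\<dots> = exp (3/20) / (2 * M) * (measure lebesgue S * (4 * M))"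
      using \<open>M > 0\<close> by simp
    also have "\<dots> \<le> exp (3/20) / (2 * M) * (measure lebesgue S * norm (avg f S - c))"
      using False \<open>M > 0\<close> by (intro mult_left_mono) auto
    also have "\<dots> \<le> exp (3/20) / (2 * M) * (LINT x:S|lebesgue. norm (f x - c))"
      using \<open>M > 0\<close> f S by (intro mult_left_mono norm_avg_diff_le) auto
    finally show ?thesis
      using measure_nonneg[of lebesgue S] by (simp add: add_increasing)
  qed
  have "(LINT x:R|lebesgue. norm (f x - c)) =
      (LINT x:P|lebesgue. norm (f x - c)) + (LINT x:Q|lebesgue. norm (f x - c))"
    using R f by (intro set_integral_bisects[OF bisect.hyps(1)] set_integrable_norm_diff
        set_integrable_const_rectangle) auto
  moreover have "measure lebesgue R = measure lebesgue P + measure lebesgue Q"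
    using R by linarith
  moreover have "(\<Sum>Q\<leftarrow>ps. measure lebesgue Q * exp (norm (avg f Q - c) / (40 * M)))
    \<le> measure lebesgue P * exp (1/10) + exp (3/20) / (2 * M) * (LINT x:P|lebesgue. norm (f x - c))"
    using R by (intro half bisect.IH) auto
  moreover have "(\<Sum>Q\<leftarrow>qs. measure lebesgue Q * exp (norm (avg f Q - c) / (40 * M)))
    \<le> measure lebesgue Q * exp (1/10) + exp (3/20) / (2 * M) * (LINT x:Q|lebesgue. norm (f x - c))"
    using R by (intro half bisect.IH) auto
  ultimately show ?case
    by (simp add: distrib_left distrib_right)
qed

text \<open>Centred at \<open>avg f R\<close>, the integral term is at most
  \<open>M * measure lebesgue R\<close>, and the two coefficients add up to at most 2. The bound is
  independent of the fineness of the partition, which is what allows a limit later.\<close>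

lemma exp_sum_bisection_partition:
  fixes f :: "real \<times> real \<Rightarrow> 'a::{banach, second_countable_topology}"
  assumes "bisection_partition R xs"
    and f: "\<And>Q. Q \<in> rectangles \<Longrightarrow> set_integrable lebesgue Q f"
    and osc: "\<And>Q. Q \<in> rectangles \<Longrightarrow>
      (LINT x:Q|lebesgue. norm (f x - avg f Q)) \<le> M * measure lebesgue Q"
    and "M > 0"
  shows "(\<Sum>Q\<leftarrow>xs. measure lebesgue Q * exp (norm (avg f Q - avg f R) / (40 * M)))
    \<le> 2 * measure lebesgue R"
proof -
  have R: "R \<in> rectangles"
    using bisection_partition_cells[OF assms(1)] by blast
  have "(\<Sum>Q\<leftarrow>xs. measure lebesgue Q * exp (norm (avg f Q - avg f R) / (40 * M)))
    \<le> measure lebesgue R * exp (1/10)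
      + exp (3/20) / (2 * M) * (LINT x:R|lebesgue. norm (f x - avg f R))"
    using assms by (intro exp_sum_bisection_partition_aux) auto
  also have "\<dots> \<le> measure lebesgue R * exp (1/10) + exp (3/20) / (2 * M) * (M * measure lebesgue R)"
    using \<open>M > 0\<close> osc[OF R] by (intro add_left_mono mult_left_mono) auto
  also have "\<dots> = measure lebesgue R * (exp (1/10) + exp (3/20) / 2)"
    using \<open>M > 0\<close> by (simp add: field_simps)
  also have "\<dots> \<le> measure lebesgue R * 2"
    using exp_tenth_add_half_exp_le_2 by (intro mult_left_mono) auto
  finally show ?thesis by simp
qed

section \<open>Approximation in L^1 by averages over fine partitions\<close>

text \<open>Replacing \<open>avg f R\<close> by \<open>c\<close> costs
  \<open>norm (avg f R - c)\<close>, which is itself at most the mean of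
  \<open>norm (f x - c)\<close>. Thus the average is, up to a factor 2, as good as any other
  constant.\<close>

lemma integral_oscillation_le:
  fixes f :: "real \<times> real \<Rightarrow> 'a::{banach, second_countable_topology}"
  assumes "R \<in> rectangles" "set_integrable lebesgue R f"
  shows "(LINT x:R|lebesgue. norm (f x - avg f R)) \<le> 2 * (LINT x:R|lebesgue. norm (f x - c))"
proof -
  note int = set_integrable_norm_diff[OF assms(2) set_integrable_const_rectangle[OF assms(1)]]
    set_integrable_const_rectangle[OF assms(1)]
  have "(LINT x:R|lebesgue. norm (f x - avg f R))
      \<le> (LINT x:R|lebesgue. norm (f x - c) + norm (avg f R - c))"
    using norm_triangle_ineq4[of "_ - c" "avg f R - c"]
    by (intro set_integral_mono int set_integral_add) auto
  also have "\<dots> = (LINT x:R|lebesgue. norm (f x - c)) + measure lebesgue R * norm (avg f R - c)"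
    by (simp add: set_integral_add(2)[OF int] set_integral_const_rectangle[OF assms(1)])
  also have "\<dots> \<le> 2 * (LINT x:R|lebesgue. norm (f x - c))"
    using norm_avg_diff_le[OF assms, of c] by simp
  finally show ?thesis .
qed

text \<open>Measurability supplies continuous functions converging almost everywhere, but without
  domination. Truncating values to a ball provides it: first \<open>f\<close> is replaced by a
  bounded function, then the continuous approximants are truncated at the same level.\<close>

lemma exists_continuous_L1_approx:
  fixes f :: "real \<times> real \<Rightarrow> 'a::euclidean_space"
  assumes "R \<in> rectangles" and f: "set_integrable lebesgue R f" and "\<epsilon> > 0"
  shows "\<exists>g. continuous_on UNIV g \<and> (LINT x:R|lebesgue. norm (f x - g x)) < \<epsilon>"
proof -
  define F where "F x = indicator R x *\<^sub>R f x" for x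
  \<comment> \<open>Nearest-point projection onto the ball of radius \<open>n\<close>: it is
    continuous, fixes the ball, and never moves a point by more than its norm.\<close>
  define clip where "clip n = closest_point (cball (0::'a) (real n))" for n
  have clip_cont: "continuous_on UNIV (clip n)" for n
    unfolding clip_def by (intro continuous_on_closest_point) auto
  have clip_norm: "norm (clip n y) \<le> real n" for n y
    using closest_point_in_set[of "cball (0::'a) (real n)" y] by (simp add: clip_def)
  have clip_diff: "norm (y - clip n y) \<le> norm y" for n y
    using closest_point_le[of "cball (0::'a) (real n)" 0 y] by (simp add: clip_def dist_norm)
  have clip_pair: "norm (clip n y - clip n z) \<le> 2 * real n" for n y z
    using norm_triangle_le_diff[OF add_mono[OF clip_norm clip_norm], of n y n z] by simp
  have clip_self: "clip n y = y" if "norm y \<le> real n" for n y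
    unfolding clip_def using that by (intro closest_point_self) auto
  have F: "integrable lebesgue F"
    using f by (simp add: F_def[abs_def] set_integrable_def)
  have clip_meas [measurable]: "clip n \<in> borel_measurable borel" for n
    by (intro borel_measurable_continuous_onI clip_cont)
  have F_meas [measurable]: "F \<in> borel_measurable lebesgue"
    using F by auto
  have R_sets [measurable]: "R \<in> sets lebesgue"
    by (rule rectangles_sets[OF assms(1)])
  \<comment> \<open>The truncation error vanishes at each point once \<open>n\<close> exceeds
    \<open>norm (F x)\<close>, and it is dominated by \<open>norm (F x)\<close>.\<close>
  have "(\<lambda>n. LINT x|lebesgue. norm (F x - clip n (F x))) \<longlonglongrightarrow> integral\<^sup>L lebesgue (\<lambda>_::real \<times> real. 0::real)"
  proof (rule integral_dominated_convergence[where s = "\<lambda>n x. norm (F x - clip n (F x))"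
        and f = "\<lambda>_. 0" and w = "\<lambda>x. norm (F x)"])
    show "AE x in lebesgue. (\<lambda>n. norm (F x - clip n (F x))) \<longlonglongrightarrow> 0"
    proof (rule AE_I2)
      fix x
      obtain N where "norm (F x) \<le> real N" using real_arch_simple by blast
      then have "norm (F x - clip n (F x)) = 0" if "n \<ge> N" for n
        using clip_self[of "F x" n] that by simp
      then show "(\<lambda>n. norm (F x - clip n (F x))) \<longlonglongrightarrow> 0"
        by (intro tendsto_eventually) (auto simp: eventually_sequentially)
    qed
  qed (use F clip_diff in auto)
  then have "eventually (\<lambda>n. (LINT x|lebesgue. norm (F x - clip n (F x))) < \<epsilon> / 2) sequentially"
    using \<open>\<epsilon> > 0\<close> by (intro order_tendstoD(2)) auto
  then obtain N where N: "(LINT x|lebesgue. norm (F x - clip N (F x))) < \<epsilon> / 2"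
    by (auto simp: eventually_sequentially)
  have "F measurable_on UNIV"
    by (rule lebesgue_measurable_imp_measurable_on) auto
  then obtain Z g where Z: "negligible Z" and g: "\<And>n. continuous_on UNIV (g n)"
    and lim: "\<And>x. x \<notin> Z \<Longrightarrow> (\<lambda>n. g n x) \<longlonglongrightarrow> F x"
    unfolding measurable_on_def by auto
  have cg: "continuous_on UNIV (\<lambda>x. clip N (g n x))" for n
    using continuous_on_compose2[OF clip_cont g] by auto
  have cg_meas [measurable]: "(\<lambda>x. clip N (g n x)) \<in> borel_measurable lebesgue" for n
    using borel_measurable_continuous_onI[OF cg] by (intro measurable_completion) simp
  \<comment> \<open>Here \<open>N\<close> is fixed, so the integrand is dominated by the constant
    \<open>2 * real N\<close> on the finite-measure set \<open>R\<close>.\<close>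
  have "(\<lambda>n. LINT x|lebesgue. indicator R x * norm (clip N (F x) - clip N (g n x)))
      \<longlonglongrightarrow> integral\<^sup>L lebesgue (\<lambda>_::real \<times> real. 0::real)"
  proof (rule integral_dominated_convergence[where f = "\<lambda>_. 0" and w = "\<lambda>x. indicator R x * (2 * real N)"
        and s = "\<lambda>n x. indicator R x * norm (clip N (F x) - clip N (g n x))"])
    show "integrable lebesgue (\<lambda>x. indicator R x * (2 * real N))"
      using set_integrable_const_rectangle[OF assms(1), of "2 * real N"] by (simp add: set_integrable_def)
    have "AE x in lebesgue. x \<notin> Z"
      using Z by (simp add: negligible_iff_null_sets AE_not_in)
    then show "AE x in lebesgue. (\<lambda>n. indicator R x * norm (clip N (F x) - clip N (g n x))) \<longlonglongrightarrow> 0"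
    proof eventually_elim
      case (elim x)
      have "isCont (clip N) (F x)"
        using clip_cont by (simp add: continuous_on_eq_continuous_at)
      then have "(\<lambda>n. clip N (g n x)) \<longlonglongrightarrow> clip N (F x)"
        using lim[OF elim] by (rule isCont_tendsto_compose)
      then have "(\<lambda>n. indicator R x * norm (clip N (F x) - clip N (g n x)))
          \<longlonglongrightarrow> indicator R x * norm (clip N (F x) - clip N (F x))"
        by (intro tendsto_intros)
      then show ?case by simp
    qed
    show "AE x in lebesgue. norm (indicator R x * norm (clip N (F x) - clip N (g n x)))
        \<le> indicator R x * (2 * real N)" for n
      using clip_pair by (intro AE_I2) (auto simp: indicator_def)
  qed auto
  then have "eventually (\<lambda>n. (LINT x|lebesgue. indicator R x * norm (clip N (F x) - clip N (g n x)))
      < \<epsilon> / 2) sequentially"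
    using \<open>\<epsilon> > 0\<close> by (intro order_tendstoD(2)) auto
  then obtain n where n: "(LINT x|lebesgue. indicator R x * norm (clip N (F x) - clip N (g n x))) < \<epsilon> / 2"
    by (auto simp: eventually_sequentially)
  have i1: "integrable lebesgue (\<lambda>x. norm (F x - clip N (F x)))"
    by (rule Bochner_Integration.integrable_bound[OF F]) (use clip_diff in auto)
  have i2: "integrable lebesgue (\<lambda>x. indicator R x * norm (clip N (F x) - clip N (g n x)))"
    by (rule Bochner_Integration.integrable_bound[where f = "\<lambda>x. indicator R x * (2 * real N)"])
      (use set_integrable_const_rectangle[OF assms(1), of "2 * real N"] clip_pair in
        \<open>auto simp: set_integrable_def indicator_def\<close>)
  have "(LINT x:R|lebesgue. norm (f x - clip N (g n x)))
      \<le> (LINT x|lebesgue. norm (F x - clip N (F x)) + indicator R x * norm (clip N (F x) - clip N (g n x)))"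
    unfolding set_lebesgue_integral_def
  proof (rule integral_mono_AE')
    show "AE x in lebesgue. indicator R x *\<^sub>R norm (f x - clip N (g n x))
        \<le> norm (F x - clip N (F x)) + indicator R x * norm (clip N (F x) - clip N (g n x))"
    proof (rule AE_I2)
      fix x
      show "indicator R x *\<^sub>R norm (f x - clip N (g n x))
        \<le> norm (F x - clip N (F x)) + indicator R x * norm (clip N (F x) - clip N (g n x))"
        using norm_triangle_ineq[of "F x - clip N (F x)" "clip N (F x) - clip N (g n x)"]
        by (cases "x \<in> R") (auto simp: F_def)
    qed
  qed (use i1 i2 in auto)
  also have "\<dots> < \<epsilon>"
    using N n by (simp add: Bochner_Integration.integral_add[OF i1 i2])
  finally show ?thesis using cg by blast
qed

lemma exists_bisection_partition_oscillation_le: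
  fixes f :: "real \<times> real \<Rightarrow> 'a::euclidean_space"
  assumes R: "R \<in> rectangles" and f: "set_integrable lebesgue R f" and "\<epsilon> > 0"
  shows "\<exists>xs. bisection_partition R xs \<and>
    (\<Sum>Q\<leftarrow>xs. LINT x:Q|lebesgue. norm (f x - avg f Q)) \<le> \<epsilon>"
proof -
  note mR = measure_rectangles_pos[OF R]
  obtain g where g: "continuous_on UNIV g" and fg: "(LINT x:R|lebesgue. norm (f x - g x)) < \<epsilon> / 4"
    using exists_continuous_L1_approx[OF R f, of "\<epsilon> / 4"] \<open>\<epsilon> > 0\<close> by auto
  \<comment> \<open>With this choice and the bound \<open>\<epsilon> / 4\<close> on the distance to
    \<open>g\<close>, the two doubled contributions at the end are at most
    \<open>\<epsilon> / 2\<close> each.\<close>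
  define \<eta> where "\<eta> = \<epsilon> / (4 * measure lebesgue R)"
  have \<eta>: "\<eta> > 0" using mR \<open>\<epsilon> > 0\<close> by (simp add: \<eta>_def)
  have "uniformly_continuous_on R g"
    using g rectangles_compact[OF R] by (intro compact_uniformly_continuous) (auto intro: continuous_on_subset)
  then obtain \<delta> where \<delta>: "\<delta> > 0" "\<And>x y. x \<in> R \<Longrightarrow> y \<in> R \<Longrightarrow> dist x y < \<delta> \<Longrightarrow> dist (g x) (g y) < \<eta>"
    using \<eta> unfolding uniformly_continuous_on_def by metis
  obtain xs where xs: "bisection_partition R xs" "\<And>Q x y. Q \<in> set xs \<Longrightarrow> x \<in> Q \<Longrightarrow> y \<in> Q \<Longrightarrow> dist x y < \<delta>"
    using exists_fine_bisection_partition[OF R \<delta>(1)] by blast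
  have gR: "set_integrable lebesgue R g"
  proof -
    have "integrable lborel (\<lambda>x. indicator R x *\<^sub>R g x)"
      using g by (intro borel_integrable_compact rectangles_compact[OF R]) (auto intro: continuous_on_subset)
    then show ?thesis
      unfolding set_integrable_def by (simp add: integrable_completion[OF borel_measurable_integrable])
  qed
  have fgR: "set_integrable lebesgue R (\<lambda>x. norm (f x - g x))"
    by (rule set_integrable_norm_diff[OF f gR])
  \<comment> \<open>On a small cell \<open>g\<close> is nearly the constant \<open>g x0\<close>; the
    oscillation of \<open>f\<close> is compared with that constant, at the price of a factor
    2.\<close>
  have cell: "(LINT x:Q|lebesgue. norm (f x - avg f Q))
      \<le> 2 * (LINT x:Q|lebesgue. norm (f x - g x)) + 2 * \<eta> * measure lebesgue Q" if "Q \<in> set xs" for Q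
  proof -
    have Q: "Q \<in> rectangles" "Q \<subseteq> R"
      using bisection_partition_cells[OF xs(1)] that by auto
    then obtain x0 where x0: "x0 \<in> Q"
      unfolding rectangles_def by force
    have int: "set_integrable lebesgue Q f" "set_integrable lebesgue Q (\<lambda>x. norm (f x - g x))"
      using Q f fgR by (auto intro: set_integrable_subset rectangles_sets)
    have "norm (f x - g x0) \<le> norm (f x - g x) + \<eta>" if "x \<in> Q" for x
    proof -
      have "dist (g x) (g x0) < \<eta>"
        using \<delta>(2) xs(2) Q(2) \<open>Q \<in> set xs\<close> that x0 by blast
      then show ?thesis
        using norm_triangle_ineq[of "f x - g x" "g x - g x0"] by (simp add: dist_norm)
    qed
    then have "(LINT x:Q|lebesgue. norm (f x - g x0)) \<le> (LINT x:Q|lebesgue. norm (f x - g x) + \<eta>)"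
      by (intro set_integral_mono set_integral_add set_integrable_norm_diff int
          set_integrable_const_rectangle Q)
    also have "\<dots> = (LINT x:Q|lebesgue. norm (f x - g x)) + \<eta> * measure lebesgue Q"
      by (simp add: set_integral_add(2)[OF int(2) set_integrable_const_rectangle[OF Q(1)]]
          set_integral_const_rectangle[OF Q(1)])
    finally show ?thesis
      using integral_oscillation_le[OF Q(1) int(1), of "g x0"] by simp
  qed
  have "(\<Sum>Q\<leftarrow>xs. LINT x:Q|lebesgue. norm (f x - avg f Q))
      \<le> (\<Sum>Q\<leftarrow>xs. 2 * (LINT x:Q|lebesgue. norm (f x - g x)) + 2 * \<eta> * measure lebesgue Q)"
    by (intro sum_list_mono cell)
  also have "\<dots> = 2 * (LINT x:R|lebesgue. norm (f x - g x)) + 2 * \<eta> * measure lebesgue R"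
    by (simp add: sum_list_addf sum_list_const_mult bisection_partition_measure[OF xs(1)]
        bisection_partition_set_integral[OF xs(1) fgR])
  also have "\<dots> \<le> \<epsilon>"
    using fg mR by (simp add: \<eta>_def)
  finally show ?thesis using xs(1) by blast
qed

section \<open>From partitions to the exponential integral via truncation\<close>

text \<open>For \<open>s > t\<close> convexity gives exp t \<ge> exp s * (1 + (t - s)), and the
  truncated value is at most \<open>K\<close>. The right side keeps the full \<open>exp t\<close>,
  because that is the quantity bounded over partitions.\<close>

lemma min_exp_le:
  fixes s t K :: real
  assumes "K \<ge> 0"
  shows "min (exp s) K \<le> exp t + K * \<bar>s - t\<bar>"
proof (cases "s \<le> t")
  case True
  then have "min (exp s) K \<le> exp t" by (simp add: min.coboundedI1)
  moreover have "0 \<le> K * \<bar>s - t\<bar>" using assms by simp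
  ultimately show ?thesis by linarith
next
  case False
  define m where "m = min (exp s) K"
  have m: "0 \<le> m" "m \<le> exp s" "m \<le> K"
    using assms by (auto simp: m_def)
  have "m * (1 - (s - t)) \<le> exp t"
  \<comment> \<open>The bound \<open>m \<le> exp s\<close> may be multiplied by
    \<open>1 - (s - t)\<close> only when that factor is nonnegative; otherwise the left side is at
    most 0.\<close>
  proof (cases "1 - (s - t) \<ge> 0")
    case True
    then have "m * (1 - (s - t)) \<le> exp s * (1 - (s - t))"
      using m(2) by (intro mult_right_mono)
    also have "\<dots> = exp s * (1 + (t - s))"
      by simp
    also have "\<dots> \<le> exp s * exp (t - s)"
      by (intro mult_left_mono exp_ge_add_one_self) auto
    finally show ?thesis by (simp flip: exp_add)
  next
    case False
    then show ?thesis
      using m(1) by (smt (verit) exp_gt_zero mult_nonneg_nonpos)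
  qed
  moreover have "m * (s - t) \<le> K * (s - t)"
    using m(3) False by (intro mult_right_mono) auto
  ultimately show ?thesis
    using False unfolding m_def[symmetric] by (simp add: algebra_simps)
qed

lemma set_integrable_min_exp:
  fixes f :: "real \<times> real \<Rightarrow> 'a::euclidean_space"
  assumes R: "R \<in> rectangles" and f: "set_integrable lebesgue R f" and "K \<ge> 0"
  shows "set_integrable lebesgue R (\<lambda>x. min (exp (norm (f x - c) / t)) K)"
proof -
  have [measurable]: "R \<in> sets lebesgue" by (rule rectangles_sets[OF R])
  \<comment> \<open>Integrability on \<open>R\<close> gives measurability only of the extension by
    zero, so the work is done with \<open>F\<close>, which agrees with \<open>f\<close> on
    \<open>R\<close>.\<close>
  define F where "F x = indicator R x *\<^sub>R f x" for x
  have [measurable]: "F \<in> borel_measurable lebesgue"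
    using f unfolding set_integrable_def F_def[abs_def] by auto
  have "set_integrable lebesgue R (\<lambda>x. min (exp (norm (F x - c) / t)) K)"
  proof (rule set_integrable_bound[OF set_integrable_const_rectangle[OF R, of K]])
    show "set_borel_measurable lebesgue R (\<lambda>x. min (exp (norm (F x - c) / t)) K)"
      unfolding set_borel_measurable_def by measurable
  qed (use \<open>K \<ge> 0\<close> in auto)
  also have "?this \<longleftrightarrow> ?thesis"
    by (intro set_integrable_cong) (auto simp: F_def)
  finally show ?thesis .
qed

text \<open>On each cell \<open>f\<close> is replaced by its average. The discrete sum is bounded by
  \<open>2 * measure lebesgue R\<close> for every partition, and the replacement error is a multiple
  of the total oscillation, which a fine partition makes small.\<close>

lemma integral_min_exp_le:
  fixes f :: "real \<times> real \<Rightarrow> 'a::euclidean_space"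
  assumes R: "R \<in> rectangles"
    and f: "\<And>Q. Q \<in> rectangles \<Longrightarrow> set_integrable lebesgue Q f"
    and osc: "\<And>Q. Q \<in> rectangles \<Longrightarrow>
      (LINT x:Q|lebesgue. norm (f x - avg f Q)) \<le> M * measure lebesgue Q"
    and "M > 0" "K \<ge> 0"
  shows "(LINT x:R|lebesgue. min (exp (norm (f x - avg f R) / (40 * M))) K) \<le> 2 * measure lebesgue R"
proof (rule field_le_epsilon)
  fix e :: real assume "e > 0"
  \<comment> \<open>The Lipschitz constant of the truncated exponential as a function of the value
    of \<open>f\<close>.\<close>
  define L where "L = K / (40 * M)"
  have L: "L \<ge> 0" using \<open>M > 0\<close> \<open>K \<ge> 0\<close> by (simp add: L_def)
  define \<phi> where "\<phi> x = min (exp (norm (f x - avg f R) / (40 * M))) K" for x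
  \<comment> \<open>Dividing by \<open>L + 1\<close> covers the case \<open>L = 0\<close>, which
    occurs for \<open>K = 0\<close>.\<close>
  have "e / (L + 1) > 0" using \<open>e > 0\<close> L by simp
  then obtain xs where xs: "bisection_partition R xs"
    "(\<Sum>Q\<leftarrow>xs. LINT x:Q|lebesgue. norm (f x - avg f Q)) \<le> e / (L + 1)"
    using exists_bisection_partition_oscillation_le[OF R f[OF R]] by blast
  have cell: "(LINT x:Q|lebesgue. \<phi> x)
      \<le> measure lebesgue Q * exp (norm (avg f Q - avg f R) / (40 * M))
        + L * (LINT x:Q|lebesgue. norm (f x - avg f Q))" if "Q \<in> set xs" for Q
  proof -
    have Q: "Q \<in> rectangles"
      using bisection_partition_cells[OF xs(1)] that by auto
    note int = set_integrable_const_rectangle[OF Q]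
      set_integrable_mult_right[OF set_integrable_norm_diff[OF f[OF Q] set_integrable_const_rectangle[OF Q]]]
    have pointwise: "\<phi> x \<le> exp (norm (avg f Q - avg f R) / (40 * M)) + L * norm (f x - avg f Q)" for x
    proof -
      define u v where "u = norm (f x - avg f R)" and "v = norm (avg f Q - avg f R)"
      have "\<bar>u - v\<bar> \<le> norm (f x - avg f Q)"
        using norm_triangle_ineq3[of "f x - avg f R" "avg f Q - avg f R"] by (simp add: u_def v_def)
      then have "L * \<bar>u - v\<bar> \<le> L * norm (f x - avg f Q)"
        using L by (intro mult_left_mono)
      moreover have "L * \<bar>u - v\<bar> = K * \<bar>u / (40 * M) - v / (40 * M)\<bar>"
        using \<open>M > 0\<close> by (simp add: L_def abs_divide flip: diff_divide_distrib)
      ultimately show ?thesis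
        using min_exp_le[OF \<open>K \<ge> 0\<close>, of "u / (40 * M)" "v / (40 * M)"]
        by (simp add: \<phi>_def u_def v_def)
    qed
    have "(LINT x:Q|lebesgue. \<phi> x)
        \<le> (LINT x:Q|lebesgue. exp (norm (avg f Q - avg f R) / (40 * M)) + L * norm (f x - avg f Q))"
      using pointwise set_integrable_min_exp[OF Q f[OF Q] \<open>K \<ge> 0\<close>] unfolding \<phi>_def
      by (intro set_integral_mono set_integral_add int) auto
    also have "\<dots> = measure lebesgue Q * exp (norm (avg f Q - avg f R) / (40 * M))
        + L * (LINT x:Q|lebesgue. norm (f x - avg f Q))"
      by (simp add: set_integral_add(2)[OF int] set_integral_const_rectangle[OF Q])
    finally show ?thesis .
  qed
  have "(LINT x:R|lebesgue. \<phi> x) = (\<Sum>Q\<leftarrow>xs. LINT x:Q|lebesgue. \<phi> x)"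
    unfolding \<phi>_def
    by (rule bisection_partition_set_integral[OF xs(1) set_integrable_min_exp[OF R f[OF R] \<open>K \<ge> 0\<close>], symmetric])
  also have "\<dots> \<le> (\<Sum>Q\<leftarrow>xs. measure lebesgue Q * exp (norm (avg f Q - avg f R) / (40 * M))
        + L * (LINT x:Q|lebesgue. norm (f x - avg f Q)))"
    by (intro sum_list_mono cell)
  also have "\<dots> = (\<Sum>Q\<leftarrow>xs. measure lebesgue Q * exp (norm (avg f Q - avg f R) / (40 * M)))
        + L * (\<Sum>Q\<leftarrow>xs. LINT x:Q|lebesgue. norm (f x - avg f Q))"
    by (simp add: sum_list_addf sum_list_const_mult)
  also have "\<dots> \<le> 2 * measure lebesgue R + L * (e / (L + 1))"
    using exp_sum_bisection_partition[OF xs(1) f osc \<open>M > 0\<close>] xs(2) L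
    by (intro add_mono mult_left_mono) auto
  also have "L * (e / (L + 1)) \<le> e"
    using L \<open>e > 0\<close> by (simp add: field_simps)
  finally show "(LINT x:R|lebesgue. min (exp (norm (f x - avg f R) / (40 * M))) K)
      \<le> 2 * measure lebesgue R + e"
    by (simp add: \<phi>_def)
qed

text \<open>The truncated bound does not depend on the level \<open>K\<close>, so letting
  \<open>K\<close> run through the naturals and using monotone convergence removes the truncation.
  Finiteness of the exponential integral is part of the conclusion, hence the nonnegative
  integral.\<close>

lemma nn_integral_exp_le:
  fixes f :: "real \<times> real \<Rightarrow> 'a::euclidean_space"
  assumes R: "R \<in> rectangles"
    and f: "\<And>Q. Q \<in> rectangles \<Longrightarrow> set_integrable lebesgue Q f"
    and osc: "\<And>Q. Q \<in> rectangles \<Longrightarrow>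
      (LINT x:Q|lebesgue. norm (f x - avg f Q)) \<le> M * measure lebesgue Q"
    and "M > 0"
  shows "(\<integral>\<^sup>+x\<in>R. ennreal (exp (norm (f x - avg f R) / (40 * M))) \<partial>lebesgue) \<le> ennreal (2 * measure lebesgue R)"
proof -
  define \<psi> where "\<psi> x = exp (norm (f x - avg f R) / (40 * M))" for x
  define h where "h n x = indicator R x *\<^sub>R min (\<psi> x) (real n)" for n x
  have h: "integrable lebesgue (h n)" for n
    using set_integrable_min_exp[OF R f[OF R], of "real n"]
    by (simp add: h_def[abs_def] \<psi>_def set_integrable_def)
  have h_nonneg: "h n x \<ge> 0" for n x
    by (simp add: h_def \<psi>_def)
  have bound: "(\<integral>\<^sup>+x. ennreal (h n x) \<partial>lebesgue) \<le> ennreal (2 * measure lebesgue R)" for n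
    using integral_min_exp_le[OF R f osc \<open>M > 0\<close>, of "real n"] h h_nonneg
    by (subst nn_integral_eq_integral)
      (auto simp: h_def[abs_def] \<psi>_def set_lebesgue_integral_def intro!: ennreal_leI)
  have "(\<lambda>n. \<integral>\<^sup>+x. ennreal (h n x) \<partial>lebesgue)
      \<longlonglongrightarrow> (\<integral>\<^sup>+x. ennreal (indicator R x *\<^sub>R \<psi> x) \<partial>lebesgue)"
  proof (rule nn_integral_LIMSEQ)
    show "incseq (\<lambda>n x. ennreal (h n x))"
      by (auto simp: incseq_def le_fun_def h_def indicator_def intro!: ennreal_leI)
    show "(\<lambda>x. ennreal (h n x)) \<in> borel_measurable lebesgue" for n
      using h[of n] by simp
    fix x
    obtain N where "\<psi> x \<le> real N" using real_arch_simple by blast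
    then have "ennreal (h n x) = ennreal (indicator R x *\<^sub>R \<psi> x)" if "n \<ge> N" for n
      using that by (simp add: h_def min_absorb1)
    then show "(\<lambda>n. ennreal (h n x)) \<longlonglongrightarrow> ennreal (indicator R x *\<^sub>R \<psi> x)"
      by (intro tendsto_eventually) (auto simp: eventually_sequentially)
  qed
  then have "(\<integral>\<^sup>+x. ennreal (indicator R x *\<^sub>R \<psi> x) \<partial>lebesgue) \<le> ennreal (2 * measure lebesgue R)"
    by (rule LIMSEQ_le_const2) (use bound in auto)
  also have "(\<integral>\<^sup>+x. ennreal (indicator R x *\<^sub>R \<psi> x) \<partial>lebesgue) = (\<integral>\<^sup>+x\<in>R. ennreal (\<psi> x) \<partial>lebesgue)"
    by (intro nn_integral_cong) (auto simp: indicator_def)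
  finally show ?thesis by (simp add: \<psi>_def)
qed

section \<open>Averages in \<open>ennreal\<close> and the equivalence\<close>

lemma set_nn_integral_norm_eq:
  fixes f :: "'b \<Rightarrow> 'a::{banach, second_countable_topology}"
  assumes "set_integrable M R f"
  shows "(\<integral>\<^sup>+x\<in>R. ennreal (norm (f x)) \<partial>M) = ennreal (LINT x:R|M. norm (f x))"
proof -
  have "(\<integral>\<^sup>+x\<in>R. ennreal (norm (f x)) \<partial>M) = (\<integral>\<^sup>+x. ennreal (norm (indicator R x *\<^sub>R f x)) \<partial>M)"
    by (intro nn_integral_cong) (auto simp: indicator_def)
  also have "\<dots> = ennreal (LINT x|M. norm (indicator R x *\<^sub>R f x))"
    using integrable_norm[OF assms[unfolded set_integrable_def]] by (intro nn_integral_eq_integral) auto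
  finally show ?thesis by (simp add: set_lebesgue_integral_def)
qed

text \<open>The measure of \<open>R\<close> is positive and finite, so the denominator can be
  cleared as for reals; if the integral is infinite, both sides are false.\<close>

lemma nn_avg_le_iff:
  assumes "R \<in> rectangles" "m \<ge> 0"
  shows "nn_avg h R \<le> ennreal m \<longleftrightarrow> (\<integral>\<^sup>+x\<in>R. h x \<partial>lebesgue) \<le> ennreal (m * measure lebesgue R)"
  using measure_rectangles_pos[OF assms(1)] assms(2) unfolding nn_avg_def emeasure_rectangles[OF assms(1)]
  by (cases "\<integral>\<^sup>+x\<in>R. h x \<partial>lebesgue")
    (simp_all add: divide_ennreal ennreal_le_iff pos_divide_le_eq ennreal_top_divide top_unique)

theorem theorem5p20:
  fixes f :: "real \<times> real \<Rightarrow> 'a::{real_normed_field, euclidean_space}"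
  assumes "locally_integrable f"
  shows "f \<in> bmo \<longleftrightarrow> f \<in> BMO_R"
proof
  have f: "set_integrable lebesgue Q f" if "Q \<in> rectangles" for Q
    using assms rectangles_compact[OF that] by (simp add: locally_integrable_def)
  have fc: "set_integrable lebesgue Q (\<lambda>x. f x - c)" if "Q \<in> rectangles" for Q c
    using f set_integrable_const_rectangle that by (intro set_integral_diff) auto
  {
    assume "f \<in> bmo"
    then have "bmo_norm f < \<infinity>" by (simp add: bmo_def)
    then obtain m where m: "m \<ge> 0" "bmo_norm f = ennreal m"
      by (cases "bmo_norm f") auto
    \<comment> \<open>Adding 1 keeps \<open>M\<close> positive even when the bmo norm is 0, since
      \<open>M\<close> is used as a divisor.\<close>
    define M where "M = m + 1"
    have "M > 0" using m(1) by (simp add: M_def)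
    have osc: "(LINT x:Q|lebesgue. norm (f x - avg f Q)) \<le> M * measure lebesgue Q"
      if Q: "Q \<in> rectangles" for Q
    proof -
      have "nn_avg (\<lambda>x. ennreal (norm (f x - avg f Q))) Q \<le> bmo_norm f"
        unfolding bmo_norm_def using Q by (rule SUP_upper)
      also have "\<dots> \<le> ennreal M"
        using m by (simp add: M_def ennreal_leI)
      finally have "ennreal (LINT x:Q|lebesgue. norm (f x - avg f Q)) \<le> ennreal (M * measure lebesgue Q)"
        unfolding nn_avg_le_iff[OF Q less_imp_le[OF \<open>M > 0\<close>]] set_nn_integral_norm_eq[OF fc[OF Q]] .
      then show ?thesis
        using \<open>M > 0\<close> by (simp add: ennreal_le_iff)
    qed
    have "expL_norm R (\<lambda>x. f x - avg f R) \<le> ennreal (40 * M)" if R: "R \<in> rectangles" for R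
    proof -
      have "nn_avg (\<lambda>x. ennreal (exp (norm (f x - avg f R) / (40 * M)))) R \<le> ennreal 2"
        unfolding nn_avg_le_iff[OF R zero_le_numeral]
        using R f osc \<open>M > 0\<close> by (rule nn_integral_exp_le)
      \<comment> \<open>The number \<open>40 * M\<close> is admissible in the infimum, the bound 2
        being the threshold in the Luxemburg norm.\<close>
      then show ?thesis
        unfolding expL_norm_def using \<open>M > 0\<close> by (intro Inf_lower) auto
    qed
    then have "BMO_R_norm f \<le> ennreal (40 * M)"
      unfolding BMO_R_norm_def by (intro SUP_least)
    then have "BMO_R_norm f < \<infinity>"
      by (simp add: le_less_trans)
    with assms show "f \<in> BMO_R" by (simp add: BMO_R_def)
  next
    assume "f \<in> BMO_R"
    then have "BMO_R_norm f < \<infinity>" by (simp add: BMO_R_def)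
    then obtain m where m: "m \<ge> 0" "BMO_R_norm f = ennreal m"
      by (cases "BMO_R_norm f") auto
    have "nn_avg (\<lambda>x. ennreal (norm (f x - avg f R))) R \<le> ennreal (2 * (m + 1))"
      if R: "R \<in> rectangles" for R
    proof -
      have "expL_norm R (\<lambda>x. f x - avg f R) \<le> BMO_R_norm f"
        unfolding BMO_R_norm_def using R by (rule SUP_upper)
      \<comment> \<open>Strictness lets an admissible \<open>t\<close> below \<open>m + 1\<close> be
        extracted without asking whether the infimum is attained.\<close>
      also have "\<dots> < ennreal (m + 1)"
        using m by (simp add: ennreal_less_iff)
      finally obtain t where t: "t > 0" "ennreal t < ennreal (m + 1)"
        and avg2: "nn_avg (\<lambda>x. ennreal (exp (norm (f x - avg f R) / t))) R \<le> 2"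
        unfolding expL_norm_def Inf_less_iff by auto
      have "t < m + 1"
        using t ennreal_less_iff[of t "m + 1"] by (simp del: ennreal_plus)
      \<comment> \<open>The elementary bound of a real number by its exponential reduces the mean
        oscillation, scaled by \<open>t\<close>, to the exponential average, which is at most
        2.\<close>
      have "(\<integral>\<^sup>+x\<in>R. ennreal (norm (f x - avg f R) / t) \<partial>lebesgue)
          \<le> (\<integral>\<^sup>+x\<in>R. ennreal (exp (norm (f x - avg f R) / t)) \<partial>lebesgue)"
        by (intro nn_integral_mono mult_right_mono ennreal_leI)
          (auto intro: order_trans[OF _ exp_ge_add_one_self])
      also have "\<dots> \<le> ennreal (2 * measure lebesgue R)"
        using avg2 nn_avg_le_iff[OF R, of 2] by simp
      also have "(\<integral>\<^sup>+x\<in>R. ennreal (norm (f x - avg f R) / t) \<partial>lebesgue)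
          = ennreal (LINT x:R|lebesgue. norm (f x - avg f R) / t)"
        using set_nn_integral_norm_eq[OF set_integrable_scaleR_right[OF fc[OF R]], of "1 / t"] t(1)
        by simp
      finally have "(LINT x:R|lebesgue. norm (f x - avg f R)) / t \<le> 2 * measure lebesgue R"
        by (simp add: ennreal_le_iff)
      then have "(LINT x:R|lebesgue. norm (f x - avg f R)) \<le> 2 * t * measure lebesgue R"
        using t(1) by (simp add: field_simps)
      also have "\<dots> \<le> 2 * (m + 1) * measure lebesgue R"
        using \<open>t < m + 1\<close> by (intro mult_right_mono) auto
      finally show ?thesis
        using m(1)
        by (intro nn_avg_le_iff[OF R, THEN iffD2]) (simp_all add: set_nn_integral_norm_eq[OF fc[OF R]] ennreal_leI)
    qed
    then have "bmo_norm f \<le> ennreal (2 * (m + 1))"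
      unfolding bmo_norm_def by (intro SUP_least)
    then have "bmo_norm f < \<infinity>"
      by (simp add: le_less_trans)
    with assms show "f \<in> bmo" by (simp add: bmo_def)
  }
qed

end
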